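(* Let $\Omega$ be a bounded domain of $\mathbb{R}^N$, and let $L=L(x,u,z)\in \mathrm{C}^2(\Omega\times\mathbb{R}\times\mathbb{R}^N)\cap \mathrm{C}^1(\overline\Omega\times\mathbb{R}\times\mathbb{R}^N)$ be a real-valued Lagrangian satisfying, for all $x\in\Omega$ and $u\in\mathbb{R}$, $$\sum_{i=1}^N L_{x_iz_i}(x,u,0)=0\qquad\text{and}\qquad L_{x_iu}(x,u,0)=0\ \text{ for all } i=1,\dots,N.$$ Let $u\in \mathrm{C}^2(\Omega)\cap \mathrm{C}^1(\overline\Omega)$ be a real-valued non-trivial classical solution of Noether's equations $$\sum_{j=1}^N\frac{\partial}{\partial x_j}\big[T_{ij}(x,u(x),Du(x))\big]+L_{x_i}(x,u(x),Du(x))=0\quad\text{for all }x\in\Omega,\ i=1,\dots,N.$$ Then $u$ is a solution of the Euler-Lagrange equation $$\sum_{j=1}^N\frac{\partial}{\partial x_j}\big[L_{z_j}(x,u(x),Du(x))\big]-L_u(x,u(x),Du(x))=0\quad\text{for all }x\in\Omega.$$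
   Context: A domain is an open connected subset of $\mathbb{R}^N$. $\mathrm{C}^1(\overline\Omega)$ denotes the set of restrictions to $\Omega$ of continuously differentiable functions on $\mathbb{R}^N$, and similarly $\mathrm{C}^1(\overline\Omega\times\mathbb{R}\times\mathbb{R}^N)$. Subscripts on $L$ denote partial derivatives with respect to the independent variables $x\in\Omega$, $u\in\mathbb{R}$, $z\in\mathbb{R}^N$ ($z$ is the slot for $Du$); $\frac{\partial}{\partial x_j}[\cdots]$ denotes the derivative of the composed function of $x$. The energy-momentum tensor is $T_{ij}(x,u,z)=z_iL_{z_j}(x,u,z)-\delta_{ij}L(x,u,z)$. A function $u$ is called non-trivial if $Du$ is not identically $0$ in $\Omega$. *)

theory Defs
  imports "HOL-Analysis.Analysis"
begin

text \<open>
  Continuous differentiability is meant on an open set \<open>S\<close>; the derivative is the Frechet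
  derivative, and its continuity is with respect to the operator norm.
\<close>

definition C1_on :: "'a::real_normed_vector set \<Rightarrow> ('a \<Rightarrow> 'b::real_normed_vector) \<Rightarrow> bool" where
  "C1_on S f \<longleftrightarrow>
     (\<exists>f' :: 'a \<Rightarrow> 'a \<Rightarrow>\<^sub>L 'b.
        (\<forall>x\<in>S. (f has_derivative blinfun_apply (f' x)) (at x)) \<and> continuous_on S f')"

definition C2_on :: "'a::real_normed_vector set \<Rightarrow> ('a \<Rightarrow> 'b::real_normed_vector) \<Rightarrow> bool" where
  "C2_on S f \<longleftrightarrow>
     (\<exists>f' :: 'a \<Rightarrow> 'a \<Rightarrow>\<^sub>L 'b.
        (\<forall>x\<in>S. (f has_derivative blinfun_apply (f' x)) (at x)) \<and> C1_on S f')"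

text \<open>
  Membership in \<open>C\<^sup>1\<close> of the closure of \<open>S\<close>: being, on \<open>S\<close>, the restriction of a function that
  is continuously differentiable on the whole space.
\<close>

definition C1_closure :: "'a::real_normed_vector set \<Rightarrow> ('a \<Rightarrow> 'b::real_normed_vector) \<Rightarrow> bool" where
  "C1_closure S f \<longleftrightarrow> (\<exists>g. C1_on UNIV g \<and> (\<forall>x\<in>S. f x = g x))"

definition partial :: "'n::finite \<Rightarrow> (real^'n \<Rightarrow> real) \<Rightarrow> real^'n \<Rightarrow> real" where
  "partial i f x = deriv (\<lambda>t. f (x + t *\<^sub>R axis i 1)) 0"

definition grad :: "(real^'n::finite \<Rightarrow> real) \<Rightarrow> real^'n \<Rightarrow> real^'n" where
  "grad f x = (\<chi> i. partial i f x)"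

text \<open>
  Partial derivatives of a Lagrangian \<open>L x u z\<close> in its independent variables. Iterated subscripts
  are read from left to right, so that \<open>diff_z j (diff_x i L)\<close> differentiates first in \<open>x\<^sub>i\<close>, then in \<open>z\<^sub>j\<close>.
\<close>

type_synonym 'n lagrangian = "real^'n \<Rightarrow> real \<Rightarrow> real^'n \<Rightarrow> real"

definition diff_x :: "'n::finite \<Rightarrow> 'n lagrangian \<Rightarrow> 'n lagrangian" where
  "diff_x i L x u z = partial i (\<lambda>y. L y u z) x"

definition diff_u :: "'n::finite lagrangian \<Rightarrow> 'n lagrangian" where
  "diff_u L x u z = deriv (\<lambda>s. L x s z) u"

definition diff_z :: "'n::finite \<Rightarrow> 'n lagrangian \<Rightarrow> 'n lagrangian" where
  "diff_z i L x u z = partial i (\<lambda>w. L x u w) z"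

definition energy_momentum :: "'n::finite lagrangian \<Rightarrow> 'n \<Rightarrow> 'n \<Rightarrow> 'n lagrangian" where
  "energy_momentum L i j x u z = z $ i * diff_z j L x u z - (if i = j then 1 else 0) * L x u z"

end

theory Submission
  imports Defs
begin

text \<open>
  By the chain rule and the symmetry of second derivatives, the \<open>i\<close>-th Noether expression equals
  \<open>u\<^sub>i\<close> times the Euler-Lagrange expression \<open>E\<close>, so \<open>Du = 0\<close> wherever \<open>E \<noteq> 0\<close>. There \<open>u\<close> is locally
  a constant \<open>c\<close>, and the two structural conditions give \<open>E = - L\<^sub>u(x, c, 0)\<close> with vanishing
  \<open>x\<close>-gradient. Hence a non-zero level set of \<open>E\<close> is open and closed in the domain, so it is empty
  or everything; the latter would make \<open>Du\<close> vanish identically.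
\<close>

section \<open>Symmetry of continuous second Frechet derivatives\<close>

lemma blinfun_apply_has_derivative:
  assumes "(f has_derivative f') (at x within S)"
  shows "((\<lambda>y. blinfun_apply (f y) k) has_derivative (\<lambda>h. blinfun_apply (f' h) k)) (at x within S)"
  using bounded_linear.has_derivative[OF blinfun.bounded_linear_left assms] .

text \<open>Two uses of the mean value theorem, along \<open>h\<close> and then along
  \<open>k\<close>. The second difference is symmetric in \<open>h\<close> and \<open>k\<close>
  while the derivative it is matched with has ordered arguments, which is what yields symmetry
  below.\<close>

lemma second_difference_mvt:
  fixes f :: "'a::real_normed_vector \<Rightarrow> real" and f' :: "'a \<Rightarrow> 'a \<Rightarrow>\<^sub>L real"
  assumes f': "\<And>y. y \<in> S \<Longrightarrow> (f has_derivative blinfun_apply (f' y)) (at y)"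
    and f'': "\<And>y. y \<in> S \<Longrightarrow> (f' has_derivative blinfun_apply (f'' y)) (at y)"
    and t: "0 < t"
    and S: "\<And>a b. a \<in> {0..t} \<Longrightarrow> b \<in> {0..t} \<Longrightarrow> x + a *\<^sub>R h + b *\<^sub>R k \<in> S"
  obtains a b where "a \<in> {0..t}" "b \<in> {0..t}"
    "f (x + t *\<^sub>R h + t *\<^sub>R k) - f (x + t *\<^sub>R h) - f (x + t *\<^sub>R k) + f x
      = t * t * f'' (x + a *\<^sub>R h + b *\<^sub>R k) k h"
proof -
  \<comment> \<open>The second difference equals \<open>g t - g 0\<close>, with \<open>g\<close> the
    increment of \<open>f\<close> over \<open>t *\<^sub>R k\<close> seen along
    \<open>h\<close>.\<close>
  define g where "g = (\<lambda>a. f (x + a *\<^sub>R h + t *\<^sub>R k) - f (x + a *\<^sub>R h))"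
  have g: "(g has_derivative
      (\<lambda>d. d * (f' (x + a *\<^sub>R h + t *\<^sub>R k) h - f' (x + a *\<^sub>R h) h))) (at a within {0..t})"
    if "0 \<le> a" "a \<le> t" for a
  proof -
    have 1: "((\<lambda>a. f (x + a *\<^sub>R h + b *\<^sub>R k)) has_derivative
        (\<lambda>d. f' (x + a *\<^sub>R h + b *\<^sub>R k) (d *\<^sub>R h))) (at a within {0..t})"
      if "b \<in> {0..t}" for b
      by (rule has_derivative_compose[where g=f, OF _ f'])
        (use that \<open>0 \<le> a\<close> \<open>a \<le> t\<close> S in \<open>auto intro!: derivative_eq_intros\<close>)
    show ?thesis unfolding g_def
      using has_derivative_diff[OF 1[of t] 1[of 0]] t
      by (simp add: blinfun.scaleR_right algebra_simps)
  qed
  from mvt_very_simple[OF less_imp_le[OF t] g] obtain a where a: "a \<in> {0..t}"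
    and ga: "g t - g 0 = t * (f' (x + a *\<^sub>R h + t *\<^sub>R k) h - f' (x + a *\<^sub>R h) h)"
    by auto
  have 2: "((\<lambda>b. f' (x + a *\<^sub>R h + b *\<^sub>R k) h) has_derivative
      (\<lambda>d. d * f'' (x + a *\<^sub>R h + b *\<^sub>R k) k h)) (at b within {0..t})"
    if "0 \<le> b" "b \<le> t" for b
  proof -
    have "((\<lambda>b. f' (x + a *\<^sub>R h + b *\<^sub>R k)) has_derivative
        (\<lambda>d. f'' (x + a *\<^sub>R h + b *\<^sub>R k) (d *\<^sub>R k))) (at b within {0..t})"
      by (rule has_derivative_compose[where g=f', OF _ f''])
        (use that a S in \<open>auto intro!: derivative_eq_intros\<close>)
    from blinfun_apply_has_derivative[OF this, of h]
    show ?thesis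
      by (simp add: blinfun.scaleR_right blinfun.scaleR_left)
  qed
  from mvt_very_simple[OF less_imp_le[OF t] 2] obtain b where b: "b \<in> {0..t}"
    and "f' (x + a *\<^sub>R h + t *\<^sub>R k) h - f' (x + a *\<^sub>R h) h
      = t * f'' (x + a *\<^sub>R h + b *\<^sub>R k) k h"
    by auto
  with ga have "f (x + t *\<^sub>R h + t *\<^sub>R k) - f (x + t *\<^sub>R h) - f (x + t *\<^sub>R k) + f x
      = t * t * f'' (x + a *\<^sub>R h + b *\<^sub>R k) k h"
    by (simp add: g_def)
  with a b show ?thesis by (rule that)
qed

text \<open>Expanding the same second difference in both orders gives
  \<open>f'' _ k h = f'' _ h k\<close> at two possibly different points of a small parallelogram at
  \<open>x\<close>. Continuity of \<open>f''\<close> brings both sides close to their values at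
  \<open>x\<close>.\<close>

lemma second_derivative_symmetric:
  fixes f :: "'a::real_normed_vector \<Rightarrow> real" and f' :: "'a \<Rightarrow> 'a \<Rightarrow>\<^sub>L real"
  assumes "open S" "x \<in> S"
    and f': "\<And>y. y \<in> S \<Longrightarrow> (f has_derivative blinfun_apply (f' y)) (at y)"
    and f'': "\<And>y. y \<in> S \<Longrightarrow> (f' has_derivative blinfun_apply (f'' y)) (at y)"
    and cont: "continuous_on S f''"
  shows "f'' x h k = f'' x k h"
proof (rule ccontr)
  assume ne: "f'' x h k \<noteq> f'' x k h"
  \<comment> \<open>Half the supposed gap: one number cannot lie within \<open>e\<close> of both
    values.\<close>
  define e where "e = dist (f'' x k h) (f'' x h k) / 2"
  have "e > 0" using ne by (simp add: e_def)
  have near: "\<forall>\<^sub>F y in nhds x. dist (f'' y h' k') (f'' x h' k') < e" for h' k'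
  proof -
    have "continuous_on S (\<lambda>y. f'' y h' k')"
      by (intro continuous_intros cont)
    then have "isCont (\<lambda>y. f'' y h' k') x"
      using \<open>open S\<close> \<open>x \<in> S\<close> continuous_on_eq_continuous_at by blast
    \<comment> \<open>The full neighbourhood filter is taken because the intermediate points may be
      \<open>x\<close> itself.\<close>
    then have "((\<lambda>y. f'' y h' k') \<longlongrightarrow> f'' x h' k') (nhds x)"
      by (simp add: isCont_def tendsto_at_iff_tendsto_nhds[of "\<lambda>y. f'' y h' k'"])
    then show ?thesis
      using \<open>e > 0\<close> by (rule tendstoD)
  qed
  have "\<forall>\<^sub>F y in nhds x. y \<in> S \<and> dist (f'' y h k) (f'' x h k) < e
      \<and> dist (f'' y k h) (f'' x k h) < e"
    using near[of h k] near[of k h] eventually_nhds_in_open[OF \<open>open S\<close> \<open>x \<in> S\<close>]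
    by eventually_elim auto
  then obtain d where "d > 0" and d: "\<And>y. dist y x < d \<Longrightarrow> y \<in> S
      \<and> dist (f'' y h k) (f'' x h k) < e \<and> dist (f'' y k h) (f'' x k h) < e"
    unfolding eventually_nhds_metric by blast
  \<comment> \<open>This size keeps the whole parallelogram in the \<open>d\<close>-ball; the
    summand 1 keeps the denominator positive when \<open>h\<close> and \<open>k\<close> both
    vanish.\<close>
  define t where "t = d / (norm h + norm k + 1)"
  have "norm h + norm k + 1 > 0" by (smt (verit) norm_ge_zero)
  then have "t > 0" and t: "t * (norm h + norm k) < d"
    using \<open>d > 0\<close> by (auto simp: t_def field_simps)
  have dist: "dist (x + a *\<^sub>R h + b *\<^sub>R k) x < d" if "a \<in> {0..t}" "b \<in> {0..t}" for a b
  proof -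
    have "dist (x + a *\<^sub>R h + b *\<^sub>R k) x = norm (a *\<^sub>R h + b *\<^sub>R k)"
      by (simp add: dist_norm algebra_simps)
    also have "\<dots> \<le> a * norm h + b * norm k"
      using that norm_triangle_ineq[of "a *\<^sub>R h" "b *\<^sub>R k"] by auto
    also have "\<dots> \<le> t * norm h + t * norm k"
      using that by (intro add_mono mult_right_mono) auto
    finally show ?thesis using t by (simp add: algebra_simps)
  qed
  have dist': "dist (x + a *\<^sub>R k + b *\<^sub>R h) x < d" if "a \<in> {0..t}" "b \<in> {0..t}" for a b
    using dist[OF that(2,1)] by (simp add: add_ac)
  obtain a b where ab: "a \<in> {0..t}" "b \<in> {0..t}"
    "f (x + t *\<^sub>R h + t *\<^sub>R k) - f (x + t *\<^sub>R h) - f (x + t *\<^sub>R k) + f x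
      = t * t * f'' (x + a *\<^sub>R h + b *\<^sub>R k) k h"
    by (rule second_difference_mvt[where f=f and S=S and x=x and h=h and k=k, OF f' f'' \<open>t > 0\<close>])
      (use dist d in blast)+
  obtain a' b' where ab': "a' \<in> {0..t}" "b' \<in> {0..t}"
    "f (x + t *\<^sub>R k + t *\<^sub>R h) - f (x + t *\<^sub>R k) - f (x + t *\<^sub>R h) + f x
      = t * t * f'' (x + a' *\<^sub>R k + b' *\<^sub>R h) h k"
    by (rule second_difference_mvt[where f=f and S=S and x=x and h=k and k=h, OF f' f'' \<open>t > 0\<close>])
      (use dist' d in blast)+
  have "x + t *\<^sub>R k + t *\<^sub>R h = x + t *\<^sub>R h + t *\<^sub>R k" by (simp add: add_ac)
  from ab(3) ab'(3)[unfolded this] have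
    "t * t * f'' (x + a *\<^sub>R h + b *\<^sub>R k) k h = t * t * f'' (x + a' *\<^sub>R k + b' *\<^sub>R h) h k"
    by linarith
  then have "f'' (x + a *\<^sub>R h + b *\<^sub>R k) k h = f'' (x + a' *\<^sub>R k + b' *\<^sub>R h) h k"
    using \<open>t > 0\<close> by (metis mult_left_cancel mult_pos_pos less_irrefl)
  moreover have "dist (f'' (x + a *\<^sub>R h + b *\<^sub>R k) k h) (f'' x k h) < e"
    "dist (f'' (x + a' *\<^sub>R k + b' *\<^sub>R h) h k) (f'' x h k) < e"
    using d dist[OF ab(1,2)] dist'[OF ab'(1,2)] by blast+
  ultimately show False unfolding e_def by (metis dist_commute dist_triangle_half_l less_irrefl)
qed

section \<open>Partial derivatives as values of Frechet derivatives\<close>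

lemma C2_onE:
  assumes "C2_on S f"
  obtains f' f'' where
    "\<And>x. x \<in> S \<Longrightarrow> (f has_derivative blinfun_apply (f' x)) (at x)"
    "\<And>x. x \<in> S \<Longrightarrow> (f' has_derivative blinfun_apply (f'' x)) (at x)"
    "continuous_on S f''"
  using assms unfolding C2_on_def C1_on_def by blast

lemma deriv_along_line:
  fixes f :: "'a::real_normed_vector \<Rightarrow> real"
  assumes "(f has_derivative f') (at x)"
  shows "deriv (\<lambda>t. f (x + t *\<^sub>R v)) 0 = f' v"
proof -
  interpret bounded_linear f' using assms by (rule has_derivative_bounded_linear)
  have "((\<lambda>t. f (x + t *\<^sub>R v)) has_derivative (\<lambda>t. f' (t *\<^sub>R v))) (at 0)"
    by (rule has_derivative_compose[where g=f]) (use assms in \<open>auto intro!: derivative_eq_intros\<close>)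
  then have "((\<lambda>t. f (x + t *\<^sub>R v)) has_field_derivative f' v) (at 0)"
    by (simp add: has_field_derivative_def scaleR mult.commute[of _ "f' v"])
  then show ?thesis by (rule DERIV_imp_deriv)
qed

lemma partial_eq:
  "(f has_derivative f') (at x) \<Longrightarrow> partial i f x = f' (axis i 1)"
  unfolding partial_def by (rule deriv_along_line)

lemma has_derivative_vec_lambda:
  fixes f :: "'a::real_normed_vector \<Rightarrow> 'n::finite \<Rightarrow> real"
  assumes "\<And>i. ((\<lambda>x. f x i) has_derivative (\<lambda>h. f' h i)) (at x)"
  shows "((\<lambda>x. \<chi> i. f x i) has_derivative (\<lambda>h. \<chi> i. f' h i)) (at x)"
  by (subst has_derivative_componentwise_within)
    (auto simp: Basis_vec_def inner_axis assms)

lemma linear_axis_sum: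
  assumes "linear (f :: real^'n::finite \<Rightarrow> real)"
  shows "f v = (\<Sum>j\<in>UNIV. v $ j * f (axis j 1))"
proof -
  interpret linear f by fact
  have "f v = f (\<Sum>j\<in>UNIV. v $ j *\<^sub>R axis j 1)"
    using basis_expansion[of v] by (simp add: scalar_mult_eq_scaleR)
  then show ?thesis by (simp add: sum scaleR)
qed

lemma
  assumes L: "((\<lambda>(x, s, z). L x s z) has_derivative L') (at (x, s, z))"
  shows diff_x_eq: "diff_x i L x s z = L' (axis i 1, 0, 0)"
    and diff_u_eq: "diff_u L x s z = L' (0, 1, 0)"
    and diff_z_eq: "diff_z i L x s z = L' (0, 0, axis i 1)"
proof -
  show "diff_x i L x s z = L' (axis i 1, 0, 0)"
    using deriv_along_line[OF L, of "(axis i 1, 0, 0)"] by (simp add: diff_x_def partial_def)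
  show "diff_z i L x s z = L' (0, 0, axis i 1)"
    using deriv_along_line[OF L, of "(0, 0, axis i 1)"] by (simp add: diff_z_def partial_def)
  \<comment> \<open>\<open>diff_u\<close> differentiates at \<open>s\<close> itself rather than at 0
    along a shifted line, so the chain rule with the embedding of the \<open>u\<close>-axis replaces
    \<open>deriv_along_line\<close>.\<close>
  interpret bounded_linear L' using L by (rule has_derivative_bounded_linear)
  have "((\<lambda>t. (x, t, z)) has_derivative (\<lambda>d. (0, d, 0))) (at s)"
    by (auto intro!: derivative_eq_intros)
  from has_derivative_compose[OF this L]
  have "((\<lambda>t. L x t z) has_derivative (\<lambda>d. L' (0, d, 0))) (at s)" by simp
  moreover have "(\<lambda>d. L' (0, d, 0)) = (*) (L' (0, 1, 0))"
  proof
    fix d show "L' (0, d, 0) = L' (0, 1, 0) * d"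
      using scaleR[of d "(0, 1, 0)"] by simp
  qed
  ultimately have "((\<lambda>t. L x t z) has_field_derivative L' (0, 1, 0)) (at s)"
    by (simp only: has_field_derivative_def)
  then show "diff_u L x s z = L' (0, 1, 0)" unfolding diff_u_def by (rule DERIV_imp_deriv)
qed

section \<open>The Euler-Lagrange expression along the jet of u\<close>

definition euler_lagrange :: "'n::finite lagrangian \<Rightarrow> (real^'n \<Rightarrow> real) \<Rightarrow> real^'n \<Rightarrow> real" where
  "euler_lagrange L u x =
    (\<Sum>j\<in>UNIV. partial j (\<lambda>y. diff_z j L y (u y) (grad u y)) x) - diff_u L x (u x) (grad u x)"

text \<open>Names the derivatives that \<open>C2_on\<close> only asserts to exist. In
  \<open>L'' p h k\<close> the vector \<open>k\<close> is the direction of the first differentiation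
  and \<open>h\<close> that of the second.\<close>

locale C2_lagrangian_and_function =
  fixes \<Omega> :: "(real^'n::finite) set" and L :: "'n lagrangian" and u :: "real^'n \<Rightarrow> real"
    and L' L'' u' u''
  assumes open_dom: "open \<Omega>"
    and L': "\<And>x s z. x \<in> \<Omega> \<Longrightarrow>
      ((\<lambda>(x, s, z). L x s z) has_derivative blinfun_apply (L' (x, s, z))) (at (x, s, z))"
    and L'': "\<And>x s z. x \<in> \<Omega> \<Longrightarrow> (L' has_derivative blinfun_apply (L'' (x, s, z))) (at (x, s, z))"
    and L''_cont: "continuous_on (\<Omega> \<times> UNIV \<times> UNIV) L''"
    and u': "\<And>x. x \<in> \<Omega> \<Longrightarrow> (u has_derivative blinfun_apply (u' x)) (at x)"
    and u'': "\<And>x. x \<in> \<Omega> \<Longrightarrow> (u' has_derivative blinfun_apply (u'' x)) (at x)"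
    and u''_cont: "continuous_on \<Omega> u''"
begin

lemma L''_symmetric:
  assumes "x \<in> \<Omega>" shows "L'' (x, s, z) h k = L'' (x, s, z) k h"
proof (rule second_derivative_symmetric[where S = "\<Omega> \<times> UNIV \<times> UNIV"])
  show "open (\<Omega> \<times> (UNIV :: real set) \<times> (UNIV :: (real^'n) set))"
    by (intro open_Times open_dom open_UNIV)
qed (use assms L' L'' L''_cont in auto)

lemma u''_symmetric: "x \<in> \<Omega> \<Longrightarrow> u'' x h k = u'' x k h"
  by (rule second_derivative_symmetric[OF open_dom _ u' u'' u''_cont])

text \<open>The 1-jet of \<open>u\<close>, at which \<open>L\<close> and its derivatives are
  evaluated. The gradient slot is written through \<open>u'\<close>, so that it can be
  differentiated by \<open>u''\<close>; it agrees with \<open>grad u\<close> on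
  \<open>\<Omega>\<close>, and openness of \<open>\<Omega>\<close> transfers derivatives from one
  form to the other.\<close>

definition jet :: "real^'n \<Rightarrow> (real^'n) \<times> real \<times> (real^'n)" where
  "jet y = (y, u y, \<chi> i. u' y (axis i 1))"

definition jet' :: "real^'n \<Rightarrow> real^'n \<Rightarrow> (real^'n) \<times> real \<times> (real^'n)" where
  "jet' y h = (h, u' y h, \<chi> i. u'' y h (axis i 1))"

lemma grad_eq: "x \<in> \<Omega> \<Longrightarrow> grad u x = (\<chi> i. u' x (axis i 1))"
  by (simp add: grad_def partial_eq[OF u'])

lemma jet_eq: "x \<in> \<Omega> \<Longrightarrow> jet x = (x, u x, grad u x)"
  by (simp add: jet_def grad_eq)

lemma u'_apply_has_derivative:
  assumes "x \<in> \<Omega>" shows "((\<lambda>y. u' y k) has_derivative (\<lambda>h. u'' x h k)) (at x)"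
  using u''[OF assms] by (rule blinfun_apply_has_derivative)

lemma jet_has_derivative:
  assumes "x \<in> \<Omega>" shows "(jet has_derivative jet' x) (at x)"
  unfolding jet_def[abs_def] jet'_def[abs_def]
  by (intro has_derivative_Pair has_derivative_ident u' has_derivative_vec_lambda
      u'_apply_has_derivative assms)

lemma L_jet_has_derivative:
  assumes "x \<in> \<Omega>"
  shows "((\<lambda>y. L y (u y) (grad u y)) has_derivative (\<lambda>h. L' (jet x) (jet' x h))) (at x)"
proof -
  have "((\<lambda>y. (\<lambda>(x, s, z). L x s z) (jet y)) has_derivative (\<lambda>h. L' (jet x) (jet' x h))) (at x)"
    by (rule has_derivative_compose[OF jet_has_derivative[OF assms]])
      (use L'[OF assms] in \<open>simp add: jet_def\<close>)
  then show ?thesis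
    by (rule has_derivative_transform_within_open[OF _ open_dom assms]) (simp add: jet_eq)
qed

lemma diff_z_jet_has_derivative:
  assumes "x \<in> \<Omega>"
  shows "((\<lambda>y. diff_z j L y (u y) (grad u y)) has_derivative
    (\<lambda>h. L'' (jet x) (jet' x h) (0, 0, axis j 1))) (at x)"
proof -
  have "((\<lambda>y. L' (jet y)) has_derivative (\<lambda>h. L'' (jet x) (jet' x h))) (at x)"
    by (rule has_derivative_compose[OF jet_has_derivative[OF assms]])
      (use L''[OF assms] in \<open>simp add: jet_def\<close>)
  from blinfun_apply_has_derivative[OF this]
  have "((\<lambda>y. L' (jet y) (0, 0, axis j 1)) has_derivative
      (\<lambda>h. L'' (jet x) (jet' x h) (0, 0, axis j 1))) (at x)" .
  then show ?thesis
    by (rule has_derivative_transform_within_open[OF _ open_dom assms])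
      (simp add: jet_eq diff_z_eq[OF L'])
qed

lemma euler_lagrange_eq:
  assumes "x \<in> \<Omega>"
  shows "euler_lagrange L u x =
    (\<Sum>j\<in>UNIV. L'' (jet x) (jet' x (axis j 1)) (0, 0, axis j 1)) - L' (jet x) (0, 1, 0)"
  by (simp add: euler_lagrange_def partial_eq[OF diff_z_jet_has_derivative[OF assms]]
      diff_u_eq[OF L'[OF assms]] jet_eq[OF assms])

text \<open>In the form \<open>euler_lagrange_eq\<close> only \<open>L'\<close>, \<open>L''\<close>,
  \<open>u'\<close>, \<open>u''\<close> and the jet occur: second derivatives are continuous by
  assumption, the rest because they are differentiable. This makes level sets relatively
  closed.\<close>

lemma continuous_on_euler_lagrange: "continuous_on \<Omega> (euler_lagrange L u)"
proof -
  have jet: "continuous_on \<Omega> jet"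
    by (rule has_derivative_continuous_on) (rule has_derivative_at_withinI[OF jet_has_derivative])
  have u'_cont: "continuous_on \<Omega> u'"
    by (rule has_derivative_continuous_on) (rule has_derivative_at_withinI[OF u''])
  have "continuous_on \<Omega> (\<lambda>x. jet' x (axis j 1))" for j
    unfolding jet'_def by (intro continuous_intros u'_cont u''_cont continuous_on_vec_lambda)
  moreover have im: "jet ` \<Omega> \<subseteq> \<Omega> \<times> UNIV \<times> UNIV" by (auto simp: jet_def)
  have "continuous_on \<Omega> (\<lambda>x. L'' (jet x))"
    by (rule continuous_on_compose2[OF L''_cont jet im])
  moreover have "continuous_on (\<Omega> \<times> UNIV \<times> UNIV) L'"
    by (rule has_derivative_continuous_on[where f' = "\<lambda>x. blinfun_apply (L'' x)"])
      (use L'' in \<open>auto intro: has_derivative_at_withinI\<close>)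
  then have "continuous_on \<Omega> (\<lambda>x. L' (jet x))"
    by (rule continuous_on_compose2[OF _ jet im])
  ultimately have "continuous_on \<Omega> (\<lambda>x.
    (\<Sum>j\<in>UNIV. L'' (jet x) (jet' x (axis j 1)) (0, 0, axis j 1)) - L' (jet x) (0, 1, 0))"
    by (intro continuous_intros)
  then show ?thesis by (simp add: euler_lagrange_eq cong: continuous_on_cong)
qed

section \<open>Factorization of the Noether expressions\<close>

text \<open>The product rule leaves three groups: \<open>u_i\<close> times the divergence of
  \<open>L_z\<close>, the sum of \<open>u_ij L_zj\<close>, and minus the total derivative of
  \<open>L\<close> in direction \<open>i\<close>. By the chain rule the last is
  \<open>L_xi + u_i L_u\<close> plus the same sum of \<open>u_ij L_zj\<close>. The sums cancel, and
  the explicit \<open>L_xi\<close> in the equation cancels the other.\<close>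

lemma noether_eq_grad_times_euler_lagrange:
  assumes x: "x \<in> \<Omega>"
  shows "(\<Sum>j\<in>UNIV. partial j (\<lambda>y. energy_momentum L i j y (u y) (grad u y)) x)
      + diff_x i L x (u x) (grad u x) = grad u x $ i * euler_lagrange L u x"
proof -
  let ?A = "L' (jet x)" and ?B = "L'' (jet x)"
  let ?e = "\<lambda>j. axis j 1 :: real^'n"
  \<comment> \<open>The Kronecker delta gets a name so that it is handled as a constant factor when
    differentiating.\<close>
  define \<delta> where "\<delta> = (\<lambda>j. if i = j then 1 else 0 :: real)"
  have grad: "((\<lambda>y. grad u y $ i) has_derivative (\<lambda>h. u'' x h (?e i))) (at x)"
    by (rule has_derivative_transform_within_open[OF u'_apply_has_derivative[OF x] open_dom x])
      (simp add: grad_eq)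
  have dz: "diff_z j L x (u x) (grad u x) = ?A (0, 0, ?e j)" for j
    by (simp add: diff_z_eq[OF L'] x jet_eq)
  have energy_momentum_\<delta>:
    "energy_momentum L i j y s z = z $ i * diff_z j L y s z - \<delta> j * L y s z" for j y s z
    by (simp add: energy_momentum_def \<delta>_def)
  have "partial j (\<lambda>y. energy_momentum L i j y (u y) (grad u y)) x
      = grad u x $ i * ?B (jet' x (?e j)) (0, 0, ?e j) + u'' x (?e j) (?e i) * ?A (0, 0, ?e j)
        - \<delta> j * ?A (jet' x (?e j))" for j
    unfolding energy_momentum_\<delta>
    using partial_eq[OF has_derivative_diff[OF
          has_derivative_mult[OF grad diff_z_jet_has_derivative[OF x, of j]]
          has_derivative_mult_right[OF L_jet_has_derivative[OF x], of "\<delta> j"]], of j]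
    by (simp add: dz)
  then have "(\<Sum>j\<in>UNIV. partial j (\<lambda>y. energy_momentum L i j y (u y) (grad u y)) x)
      = grad u x $ i * (\<Sum>j\<in>UNIV. ?B (jet' x (?e j)) (0, 0, ?e j))
        + (\<Sum>j\<in>UNIV. u'' x (?e i) (?e j) * ?A (0, 0, ?e j)) - (\<Sum>j\<in>UNIV. \<delta> j * ?A (jet' x (?e j)))"
    \<comment> \<open>Symmetry of \<open>u''\<close> puts the mixed terms in the order in which the
      chain rule for \<open>L\<close> produces them.\<close>
    by (simp add: sum.distrib sum_subtractf sum_distrib_left u''_symmetric[OF x, of _ "?e i"])
  also have "(\<Sum>j\<in>UNIV. \<delta> j * ?A (jet' x (?e j))) = ?A (jet' x (?e i))"
    by (simp add: \<delta>_def if_distrib[of "\<lambda>a. a * _"] cong: if_cong)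
  also have "?A (jet' x (?e i)) = ?A (?e i, 0, 0) + grad u x $ i * ?A (0, 1, 0)
      + (\<Sum>j\<in>UNIV. u'' x (?e i) (?e j) * ?A (0, 0, ?e j))"
  proof -
    \<comment> \<open>Splitting into the three slots separates the contributions of
      \<open>L_x\<close>, \<open>L_u\<close> and \<open>L_z\<close>.\<close>
    have "jet' x (?e i) = (?e i, 0, 0) + u' x (?e i) *\<^sub>R (0, 1, 0)
        + (0, 0, \<chi> j. u'' x (?e i) (?e j))"
      by (simp add: jet'_def)
    then have "?A (jet' x (?e i)) = ?A (?e i, 0, 0) + u' x (?e i) * ?A (0, 1, 0)
        + ?A (0, 0, \<chi> j. u'' x (?e i) (?e j))"
      by (simp only: blinfun.add_right blinfun.scaleR_right real_scaleR_def)
    moreover have "linear (\<lambda>v. ?A (0, 0, v))"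
    proof -
      have "linear (\<lambda>v::real^'n. (0::real^'n, 0::real, v))"
        by (rule linearI) auto
      from linear_compose[OF this bounded_linear.linear[OF blinfun.bounded_linear_right[of ?A]]]
      show ?thesis by (simp add: o_def)
    qed
    ultimately show ?thesis
      by (simp add: linear_axis_sum[of "\<lambda>v. ?A (0, 0, v)" "\<chi> j. u'' x (?e i) (?e j)"] grad_eq[OF x])
  qed
  finally show ?thesis
    by (simp add: euler_lagrange_eq[OF x] diff_x_eq[OF L'[OF x]] jet_eq[OF x] algebra_simps)
qed

section \<open>Regions where the gradient vanishes\<close>

text \<open>Near the point, \<open>diff_x i L\<close> is \<open>L'\<close> applied to a fixed
  vector, so differentiating once more gives entries of \<open>L''\<close>. This restates the two
  structural conditions in terms of \<open>L''\<close>.\<close>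

lemma
  assumes "x \<in> \<Omega>"
  shows diff_z_diff_x_eq: "diff_z j (diff_x i L) x s z = L'' (x, s, z) (0, 0, axis j 1) (axis i 1, 0, 0)"
    and diff_u_diff_x_eq: "diff_u (diff_x i L) x s z = L'' (x, s, z) (0, 1, 0) (axis i 1, 0, 0)"
proof -
  have "((\<lambda>y. L' y (axis i 1, 0, 0)) has_derivative
      (\<lambda>h. L'' (x, s, z) h (axis i 1, 0, 0))) (at (x, s, z))"
    using L''[OF assms] by (rule blinfun_apply_has_derivative)
  then have *: "((\<lambda>(x, s, z). diff_x i L x s z) has_derivative
      (\<lambda>h. L'' (x, s, z) h (axis i 1, 0, 0))) (at (x, s, z))"
    by (rule has_derivative_transform_within_open[where s = "\<Omega> \<times> UNIV \<times> UNIV"])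
      (use assms open_dom in \<open>auto simp: diff_x_eq[OF L'] intro!: open_Times\<close>)
  show "diff_z j (diff_x i L) x s z = L'' (x, s, z) (0, 0, axis j 1) (axis i 1, 0, 0)"
    and "diff_u (diff_x i L) x s z = L'' (x, s, z) (0, 1, 0) (axis i 1, 0, 0)"
    by (rule diff_z_eq[OF *], rule diff_u_eq[OF *])
qed

text \<open>Balls are convex, so a vanishing derivative forces constancy; this is used first for
  \<open>u\<close> and then for \<open>L_u\<close> along the points
  \<open>(x, c, 0)\<close>.\<close>

lemma euler_lagrange_constant_on_ball:
  assumes L_xz: "\<And>x s. x \<in> \<Omega> \<Longrightarrow> (\<Sum>i\<in>UNIV. diff_z i (diff_x i L) x s 0) = 0"
    and L_xu: "\<And>x s i. x \<in> \<Omega> \<Longrightarrow> diff_u (diff_x i L) x s 0 = 0"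
    and ball: "ball a r \<subseteq> \<Omega>" and grad: "\<And>x. x \<in> ball a r \<Longrightarrow> grad u x = 0"
    and y: "y \<in> ball a r" and y': "y' \<in> ball a r"
  shows "euler_lagrange L u y = euler_lagrange L u y'"
proof -
  have u'_0: "u' x = 0" if "x \<in> ball a r" for x
  proof (rule blinfun_eqI)
    fix v
    have "u' x v = (\<Sum>j\<in>UNIV. v $ j * grad u x $ j)"
      using linear_axis_sum[OF bounded_linear.linear[OF blinfun.bounded_linear_right[of "u' x"]], of v]
        that ball
      by (simp add: grad_eq subset_iff)
    then show "u' x v = blinfun_apply 0 v" using grad[OF that] by simp
  qed
  have u''_0: "u'' x h = 0" if "x \<in> ball a r" for x h
  proof -
    \<comment> \<open>\<open>u'\<close> vanishes on an open set, not just at \<open>x\<close>, hence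
      so does its derivative.\<close>
    have "(u' has_derivative (\<lambda>h. 0)) (at x)"
      by (rule has_derivative_transform_within_open[OF has_derivative_const[of 0] open_ball that])
        (simp add: u'_0)
    moreover have "(u' has_derivative blinfun_apply (u'' x)) (at x)"
      using u'' that ball by blast
    ultimately show ?thesis by (metis has_derivative_unique)
  qed
  define c where "c = u y"
  have u_c: "u x = c" if "x \<in> ball a r" for x
    unfolding c_def
  proof (rule has_derivative_zero_unique[OF convex_ball _ that y])
    fix x assume "x \<in> ball a r"
    with u'[of x] u'_0 ball have "(u has_derivative (\<lambda>h. 0)) (at x)"
      by (auto simp: zero_blinfun.rep_eq subset_iff)
    then show "(u has_derivative (\<lambda>h. 0)) (at x within ball a r)" by (rule has_derivative_at_withinI)
  qed
  have EL: "euler_lagrange L u x = - L' (x, c, 0) (0, 1, 0)" if x: "x \<in> ball a r" for x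
  proof -
    from x ball have x': "x \<in> \<Omega>" by auto
    have "jet x = (x, c, 0)" "jet' x h = (h, 0, 0)" for h
      using u'_0[OF x] u''_0[OF x] u_c[OF x] by (simp_all add: jet_def jet'_def zero_vec_def)
    \<comment> \<open>The divergence differentiates \<open>L_z\<close> in \<open>x\<close>, whereas
      the hypothesis differentiates \<open>L_x\<close> in \<open>z\<close>; symmetry of
      \<open>L''\<close> exchanges them.\<close>
    moreover have "(\<Sum>j\<in>UNIV. L'' (x, c, 0) (axis j 1, 0, 0) (0, 0, axis j 1)) = 0"
      using L_xz[OF x', of c]
      by (simp add: diff_z_diff_x_eq[OF x'] L''_symmetric[OF x', of _ _ "(axis _ 1, 0, 0)"])
    ultimately show ?thesis by (simp add: euler_lagrange_eq[OF x'])
  qed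
  have "L' (y, c, 0) (0, 1, 0) = L' (y', c, 0) (0, 1, 0)"
  proof (rule has_derivative_zero_unique[where f = "\<lambda>x. L' (x, c, 0) (0, 1, 0)", OF convex_ball _ y y'])
    fix x assume "x \<in> ball a r"
    with ball have x': "x \<in> \<Omega>" by auto
    have "((\<lambda>x. (x, c, 0)) has_derivative (\<lambda>h. (h, 0, 0))) (at x)"
      by (intro has_derivative_Pair has_derivative_ident has_derivative_const)
    from blinfun_apply_has_derivative[OF has_derivative_compose[OF this L''[OF x']]]
    have "((\<lambda>x. L' (x, c, 0) (0, 1, 0)) has_derivative
        (\<lambda>h. L'' (x, c, 0) (h, 0, 0) (0, 1, 0))) (at x)" .
    \<comment> \<open>This is the \<open>x\<close>-derivative of \<open>L_u\<close>; after
      exchanging the order it is a combination of the vanishing \<open>L_xu\<close> entries.\<close>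
    moreover have "L'' (x, c, 0) (h, 0, 0) (0, 1, 0) = 0" for h
    proof -
      have "linear (\<lambda>h. L'' (x, c, 0) (0, 1, 0) (h, 0, 0))"
      proof -
        have "linear (\<lambda>v::real^'n. (v, 0::real, 0::real^'n))"
          by (rule linearI) auto
        from linear_compose[OF this
            bounded_linear.linear[OF blinfun.bounded_linear_right[of "L'' (x, c, 0) (0, 1, 0)"]]]
        show ?thesis by (simp add: o_def)
      qed
      from linear_axis_sum[OF this, of h] show ?thesis
        using L_xu[OF x', of _ c]
        by (simp add: diff_u_diff_x_eq[OF x'] L''_symmetric[OF x', of _ _ "(h, 0, 0)"])
    qed
    ultimately show "((\<lambda>x. L' (x, c, 0) (0, 1, 0)) has_derivative (\<lambda>h. 0)) (at x within ball a r)"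
      by (simp add: has_derivative_at_withinI)
  qed
  then show ?thesis by (simp only: EL[OF y] EL[OF y'])
qed

section \<open>Connectedness argument\<close>

lemma euler_lagrange_of_noether:
  assumes conn: "connected \<Omega>"
    and L_xz: "\<And>x s. x \<in> \<Omega> \<Longrightarrow> (\<Sum>i\<in>UNIV. diff_z i (diff_x i L) x s 0) = 0"
    and L_xu: "\<And>x s i. x \<in> \<Omega> \<Longrightarrow> diff_u (diff_x i L) x s 0 = 0"
    and nontrivial: "x0 \<in> \<Omega>" "grad u x0 \<noteq> 0"
    and noether: "\<And>x i. x \<in> \<Omega> \<Longrightarrow>
      (\<Sum>j\<in>UNIV. partial j (\<lambda>y. energy_momentum L i j y (u y) (grad u y)) x)
        + diff_x i L x (u x) (grad u x) = 0"
    and a: "a \<in> \<Omega>"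
  shows "euler_lagrange L u a = 0"
proof (rule ccontr)
  let ?E = "euler_lagrange L u"
  assume a0: "?E a \<noteq> 0"
  \<comment> \<open>The level set through the supposed bad point. It lies where \<open>?E\<close> is
    non-zero, so the gradient vanishes on it.\<close>
  define S where "S = {x \<in> \<Omega>. ?E x = ?E a}"
  have grad_0: "grad u x = 0" if "x \<in> \<Omega>" "?E x \<noteq> 0" for x
  proof -
    have "grad u x $ i * ?E x = 0" for i
      using noether_eq_grad_times_euler_lagrange[OF that(1), of i] noether[OF that(1), of i]
      by (rule trans[OF sym])
    with that(2) show ?thesis by (simp add: vec_eq_iff)
  qed
  have "closedin (top_of_set \<Omega>) S"
    unfolding S_def by (rule continuous_closedin_preimage_constant[OF continuous_on_euler_lagrange])
  moreover have "open S"
    unfolding open_contains_ball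
  proof
    fix b assume "b \<in> S"
    then have b: "b \<in> \<Omega>" "?E b = ?E a" by (auto simp: S_def)
    \<comment> \<open>Around \<open>b\<close> a whole ball avoids the zeros of \<open>?E\<close>, so
      the gradient vanishes throughout that ball and the constancy lemma applies.\<close>
    have "open (\<Omega> \<inter> ?E -` (- {0}))"
      by (intro continuous_open_preimage continuous_on_euler_lagrange open_dom) auto
    moreover have "b \<in> \<Omega> \<inter> ?E -` (- {0})"
      using b a0 by simp
    ultimately obtain r where "r > 0" and r: "ball b r \<subseteq> \<Omega> \<inter> ?E -` (- {0})"
      by (rule openE)
    have "?E x = ?E a" if "x \<in> ball b r" for x
      unfolding b(2)[symmetric]
      by (rule euler_lagrange_constant_on_ball[where a = b and r = r, OF L_xz L_xu])
        (use r grad_0 that \<open>r > 0\<close> in \<open>auto simp: subset_iff\<close>)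
    with r b \<open>r > 0\<close> show "\<exists>e>0. ball b e \<subseteq> S" unfolding S_def by auto
  qed
  then have "openin (top_of_set \<Omega>) S"
    by (intro open_subset) (auto simp: S_def)
  ultimately have "S = \<Omega>"
    using conn a unfolding connected_clopen
    by (metis (mono_tags, lifting) S_def empty_iff mem_Collect_eq)
  \<comment> \<open>Filling the domain, \<open>S\<close> contains the point of non-zero gradient,
    where \<open>?E\<close> would have to be zero.\<close>
  with nontrivial(1) have "x0 \<in> S" by simp
  then have "?E x0 \<noteq> 0" using a0 by (simp add: S_def)
  with grad_0 nontrivial show False by blast
qed

end

theorem theorem3:
  fixes \<Omega> :: "(real^'n::finite) set"
    and L :: "real^'n \<Rightarrow> real \<Rightarrow> real^'n \<Rightarrow> real"
    and u :: "real^'n \<Rightarrow> real"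
  assumes domain: "open \<Omega>" "connected \<Omega>" "bounded \<Omega>"
    and L_C2: "C2_on (\<Omega> \<times> UNIV \<times> UNIV) (\<lambda>(x, s, z). L x s z)"
    and L_C1: "C1_closure (\<Omega> \<times> UNIV \<times> UNIV) (\<lambda>(x, s, z). L x s z)"
    and L_xz: "\<forall>x\<in>\<Omega>. \<forall>s. (\<Sum>i\<in>UNIV. diff_z i (diff_x i L) x s 0) = 0"
    and L_xu: "\<forall>x\<in>\<Omega>. \<forall>s. \<forall>i. diff_u (diff_x i L) x s 0 = 0"
    and u_C2: "C2_on \<Omega> u"
    and u_C1: "C1_closure \<Omega> u"
    and nontrivial: "\<exists>x\<in>\<Omega>. grad u x \<noteq> 0"
    and noether: "\<forall>x\<in>\<Omega>. \<forall>i.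
      (\<Sum>j\<in>UNIV. partial j (\<lambda>y. energy_momentum L i j y (u y) (grad u y)) x)
        + diff_x i L x (u x) (grad u x) = 0"
  shows "\<forall>x\<in>\<Omega>.
      (\<Sum>j\<in>UNIV. partial j (\<lambda>y. diff_z j L y (u y) (grad u y)) x)
        - diff_u L x (u x) (grad u x) = 0"


proof -
  obtain L' L'' where L:
    "\<And>x. x \<in> \<Omega> \<times> UNIV \<times> UNIV \<Longrightarrow> ((\<lambda>(x, s, z). L x s z) has_derivative blinfun_apply (L' x)) (at x)"
    "\<And>x. x \<in> \<Omega> \<times> UNIV \<times> UNIV \<Longrightarrow> (L' has_derivative blinfun_apply (L'' x)) (at x)"
    "continuous_on (\<Omega> \<times> UNIV \<times> UNIV) L''"
    using L_C2 by (rule C2_onE) blast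
  obtain u' u'' where u:
    "\<And>x. x \<in> \<Omega> \<Longrightarrow> (u has_derivative blinfun_apply (u' x)) (at x)"
    "\<And>x. x \<in> \<Omega> \<Longrightarrow> (u' has_derivative blinfun_apply (u'' x)) (at x)"
    "continuous_on \<Omega> u''"
    using u_C2 by (rule C2_onE) blast
  interpret C2_lagrangian_and_function \<Omega> L u L' L'' u' u''
    by unfold_locales (use domain L u in auto)
  show ?thesis
    using euler_lagrange_of_noether[OF domain(2)] L_xz L_xu nontrivial noether
    unfolding euler_lagrange_def by blast
qed

end
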